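(* Let $G$ be a finite connected graph. If $G$ is a partial cube, then the relation $\varphi$ on $E(G)$ coincides with the Djoković–Winkler relation $\theta$, is an equivalence relation on $E(G)$, and its classes are exactly the Djoković cuts of $G$. Conversely, if $G$ is bipartite, $\varphi$ is an equivalence relation on $E(G)$, and each $\varphi$-class induces an edge cut with convex sides, then $G$ is a partial cube and its $\theta$-classes are equal to its $\varphi$-classes.
   Context: $d=d_G$ is the shortest-path metric of the finite connected graph $G$. For edges $e=\{u,v\}$ and $f=\{x,y\}$ of $G$: - $e\,\varphi\,f$ means $d(u,x)=d(v,y)$ and $d(u,y)=d(v,x)$ (this does not depend on how the endpoints are named). - $e\,\theta\,f$ (Djoković–Winkler relation) means $d(u,x)+d(v,y)\ne d(u,y)+d(v,x)$. A partial cube is a graph $G$ admitting an isometric (distance-preserving) map of its vertices into a hypercube $Q_p$, i.e. binary labels in $\mathbb{Z}_2^p$ under which graph distance equals Hamming distance. For an edge $\{u,v\}$ let $W_{uv}=\{w\in V(G): d(w,u)<d(w,v)\}$ and $W_{vu}=\{w: d(w,v)<d(w,u)\}$; the Djoković cut of $\{u,v\}$ in a partial cube is the set of edges with one end in $W_{uv}$ and the other in $W_{vu}$. A set $F\subseteq E(G)$ induces an edge cut with convex sides if there is a partition $V(G)=A_F\sqcup B_F$ such that $F$ is exactly the set of edges with one end in $A_F$ and the other in $B_F$, and both $A_F$ and $B_F$ are convex (a vertex set is convex if it contains every vertex of every shortest path of $G$ between two of its members). *)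

theory Defs
  imports Main
begin

text \<open>A graph is a vertex set \<open>V\<close> together with a set \<open>E\<close> of two-element subsets of \<open>V\<close>.\<close>

definition simple_graph :: "'a set \<Rightarrow> 'a set set \<Rightarrow> bool" where
  "simple_graph V E \<longleftrightarrow> E \<subseteq> {{u, v} | u v. u \<in> V \<and> v \<in> V \<and> u \<noteq> v}"

definition walk_betw :: "'a set \<Rightarrow> 'a set set \<Rightarrow> 'a \<Rightarrow> 'a list \<Rightarrow> 'a \<Rightarrow> bool" where
  "walk_betw V E u p v \<longleftrightarrow>
     p \<noteq> [] \<and> hd p = u \<and> last p = v \<and> set p \<subseteq> V \<and> successively (\<lambda>a b. {a, b} \<in> E) p"

definition connected_graph :: "'a set \<Rightarrow> 'a set set \<Rightarrow> bool" where
  "connected_graph V E \<longleftrightarrow> (\<forall>u\<in>V. \<forall>v\<in>V. \<exists>p. walk_betw V E u p v)"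

definition bipartite_graph :: "'a set \<Rightarrow> 'a set set \<Rightarrow> bool" where
  "bipartite_graph V E \<longleftrightarrow>
     (\<exists>X Y. X \<union> Y = V \<and> X \<inter> Y = {} \<and> (\<forall>e\<in>E. \<exists>x\<in>X. \<exists>y\<in>Y. e = {x, y}))"

text \<open>
  The length of a walk is its number of edges, one less than the length of its vertex list.
  The value of \<open>gdist\<close> is meaningful only for vertices joined by some walk.
\<close>

definition gdist :: "'a set \<Rightarrow> 'a set set \<Rightarrow> 'a \<Rightarrow> 'a \<Rightarrow> nat" where
  "gdist V E u v = (LEAST n. \<exists>p. walk_betw V E u p v \<and> length p = Suc n)"

text \<open>A walk of minimal length repeats no vertex, so it is a path without further assumptions.\<close>

definition shortest_path :: "'a set \<Rightarrow> 'a set set \<Rightarrow> 'a \<Rightarrow> 'a list \<Rightarrow> 'a \<Rightarrow> bool" where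
  "shortest_path V E u p v \<longleftrightarrow> walk_betw V E u p v \<and> length p = Suc (gdist V E u v)"

definition convex_in :: "'a set \<Rightarrow> 'a set set \<Rightarrow> 'a set \<Rightarrow> bool" where
  "convex_in V E S \<longleftrightarrow>
     S \<subseteq> V \<and> (\<forall>u\<in>S. \<forall>v\<in>S. \<forall>p. shortest_path V E u p v \<longrightarrow> set p \<subseteq> S)"

text \<open>
  The defining conditions of \<open>phi_rel\<close> and \<open>theta_rel\<close> are invariant under swapping the names of
  the two ends of either edge, so quantifying existentially over the names is harmless; see
  \<open>phi_rel_iff\<close> and \<open>theta_rel_iff\<close> below.
\<close>

definition phi_rel :: "'a set \<Rightarrow> 'a set set \<Rightarrow> 'a set rel" where
  "phi_rel V E = {(e, f). e \<in> E \<and> f \<in> E \<and>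
     (\<exists>u v x y. e = {u, v} \<and> f = {x, y} \<and>
        gdist V E u x = gdist V E v y \<and> gdist V E u y = gdist V E v x)}"

definition theta_rel :: "'a set \<Rightarrow> 'a set set \<Rightarrow> 'a set rel" where
  "theta_rel V E = {(e, f). e \<in> E \<and> f \<in> E \<and>
     (\<exists>u v x y. e = {u, v} \<and> f = {x, y} \<and>
        gdist V E u x + gdist V E v y \<noteq> gdist V E u y + gdist V E v x)}"

lemma phi_rel_iff:
  "({u, v}, {x, y}) \<in> phi_rel V E \<longleftrightarrow>
     {u, v} \<in> E \<and> {x, y} \<in> E \<and> gdist V E u x = gdist V E v y \<and> gdist V E u y = gdist V E v x"
  unfolding phi_rel_def by (auto simp: doubleton_eq_iff)

lemma theta_rel_iff:
  "({u, v}, {x, y}) \<in> theta_rel V E \<longleftrightarrow>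
     {u, v} \<in> E \<and> {x, y} \<in> E \<and>
     gdist V E u x + gdist V E v y \<noteq> gdist V E u y + gdist V E v x"
  unfolding theta_rel_def by (auto simp: doubleton_eq_iff)

text \<open>The vertices of the hypercube \<open>Q\<^sub>p\<close> are the binary words of length \<open>p\<close>.\<close>

definition hypercube :: "nat \<Rightarrow> bool list set" where
  "hypercube p = {xs. length xs = p}"

definition hamming :: "bool list \<Rightarrow> bool list \<Rightarrow> nat" where
  "hamming xs ys = card {i. i < length xs \<and> xs ! i \<noteq> ys ! i}"

definition partial_cube :: "'a set \<Rightarrow> 'a set set \<Rightarrow> bool" where
  "partial_cube V E \<longleftrightarrow>
     (\<exists>p l. l ` V \<subseteq> hypercube p \<and> (\<forall>u\<in>V. \<forall>v\<in>V. gdist V E u v = hamming (l u) (l v)))"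

definition edges_between :: "'a set set \<Rightarrow> 'a set \<Rightarrow> 'a set \<Rightarrow> 'a set set" where
  "edges_between E A B = {e \<in> E. \<exists>a\<in>A. \<exists>b\<in>B. e = {a, b}}"

definition closer :: "'a set \<Rightarrow> 'a set set \<Rightarrow> 'a \<Rightarrow> 'a \<Rightarrow> 'a set" where
  "closer V E u v = {w \<in> V. gdist V E w u < gdist V E w v}"

definition djokovic_cut :: "'a set \<Rightarrow> 'a set set \<Rightarrow> 'a \<Rightarrow> 'a \<Rightarrow> 'a set set" where
  "djokovic_cut V E u v = edges_between E (closer V E u v) (closer V E v u)"

definition convex_edge_cut :: "'a set \<Rightarrow> 'a set set \<Rightarrow> 'a set set \<Rightarrow> bool" where
  "convex_edge_cut V E F \<longleftrightarrow>
     (\<exists>A B. A \<union> B = V \<and> A \<inter> B = {} \<and> F = edges_between E A B \<and>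
        convex_in V E A \<and> convex_in V E B)"

end

theory Submission
  imports Defs
begin

text \<open>
  In a partial cube every edge flips exactly one coordinate, and both \<open>\<phi>\<close> and \<open>\<theta>\<close> say that two
  edges flip the same one. Conversely, if a partition of the edges consists of cuts with convex
  sides, then the last edge of a shortest path from \<open>u\<close> to \<open>v\<close> lies in a cut that no earlier edge of
  the path crosses, since otherwise convexity would keep the whole path on the side of \<open>v\<close>. So by
  induction the distance is the number of cuts separating \<open>u\<close> from \<open>v\<close>, and recording the side of a
  vertex for each cut gives an isometric labelling.
\<close>

section \<open>Distances and shortest paths in connected graphs\<close>

lemma edge_vertices:
  assumes "simple_graph V E" and "{u, v} \<in> E"
  shows "u \<in> V" and "v \<in> V" and "u \<noteq> v"
proof -
  have "{u, v} \<in> {{u, v} | u v. u \<in> V \<and> v \<in> V \<and> u \<noteq> v}"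
    using assms unfolding simple_graph_def by (rule subsetD)
  then show "u \<in> V" and "v \<in> V" and "u \<noteq> v" by (auto simp: doubleton_eq_iff)
qed

lemma edge_obtain:
  assumes "simple_graph V E" and "e \<in> E"
  obtains u v where "e = {u, v}"
  using assms unfolding simple_graph_def by blast

lemma finite_edges:
  assumes "simple_graph V E" and "finite V"
  shows "finite E"
proof (rule finite_subset)
  show "E \<subseteq> Pow V" using assms(1) unfolding simple_graph_def by auto
qed (use assms(2) in simp)

lemma gdist_le:
  assumes "walk_betw V E u p v" and "length p = Suc n"
  shows "gdist V E u v \<le> n"
  unfolding gdist_def using assms by (intro Least_le) blast

lemma shortest_path_exists:
  assumes "connected_graph V E" and "u \<in> V" and "v \<in> V"
  obtains p where "shortest_path V E u p v"
proof -
  obtain p where p: "walk_betw V E u p v"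
    using assms unfolding connected_graph_def by blast
  then have "p \<noteq> []" by (simp add: walk_betw_def)
  then have "length p = Suc (length p - 1)" by simp
  with p have "\<exists>n p. walk_betw V E u p v \<and> length p = Suc n" by blast
  then have "\<exists>p. walk_betw V E u p v \<and> length p = Suc (gdist V E u v)"
    unfolding gdist_def by (rule LeastI_ex)
  then show thesis using that unfolding shortest_path_def by blast
qed

lemma gdist_eq_0:
  assumes "connected_graph V E" and "u \<in> V" and "v \<in> V" and "gdist V E u v = 0"
  shows "u = v"
proof -
  obtain p where "shortest_path V E u p v" using shortest_path_exists assms by metis
  then show ?thesis
    using assms(4) by (auto simp: shortest_path_def walk_betw_def length_Suc_conv)
qed

lemma gdist_edge:
  assumes "simple_graph V E" and "connected_graph V E" and "{u, v} \<in> E"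
  shows "gdist V E u v = 1"
proof -
  note uv = edge_vertices[OF assms(1,3)]
  have "gdist V E u v \<le> 1"
    using uv assms(3) by (intro gdist_le[of V E u "[u, v]"]) (auto simp: walk_betw_def)
  moreover have "gdist V E u v \<noteq> 0"
    using gdist_eq_0[OF assms(2)] uv by blast
  ultimately show ?thesis by simp
qed

text \<open>Provides the induction step along distances from a fixed \<open>u\<close>: the
  penultimate vertex \<open>w\<close> of a shortest path is one step closer. The path
  \<open>p\<close> itself is returned as well, so that convexity can later be applied to it.\<close>

lemma shortest_path_last_edge:
  assumes "connected_graph V E" and "u \<in> V" and "v \<in> V" and "gdist V E u v = Suc n"
  obtains w p where "w \<in> V" "{w, v} \<in> E" "gdist V E u w = n"
    "shortest_path V E u p v" "w \<in> set p"
proof -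
  obtain p where p: "shortest_path V E u p v"
    using shortest_path_exists assms by metis
  then have walk: "walk_betw V E u p v" and len: "length p = Suc (Suc n)"
    using assms(4) by (auto simp: shortest_path_def)
  define q where "q = butlast p"
  have lq: "length q = Suc n" and pq: "p = q @ [v]"
    using walk len append_butlast_last_id[of p] unfolding q_def walk_betw_def by auto
  define w where "w = last q"
  have q: "q \<noteq> []" using lq by auto
  have succ: "successively (\<lambda>a b. {a, b} \<in> E) q" and wv: "{w, v} \<in> E"
    using walk q unfolding pq walk_betw_def w_def by (auto simp: successively_append_iff)
  have wq: "walk_betw V E u q w"
    using walk q succ unfolding pq walk_betw_def w_def by auto
  have wV: "w \<in> V" using wq q unfolding walk_betw_def by auto
  \<comment> \<open>The prefix \<open>q\<close> only bounds the distance to \<open>w\<close> from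
    above. For the lower bound, a shortest path \<open>r\<close> to \<open>w\<close> is extended by
    \<open>v\<close>; a shorter \<open>r\<close> would give a walk to \<open>v\<close> below its
    distance.\<close>
  obtain r where r: "shortest_path V E u r w"
    using shortest_path_exists[OF assms(1,2) wV] .
  have "walk_betw V E u (r @ [v]) v"
    using r wv assms(3) unfolding shortest_path_def walk_betw_def
    by (auto simp: successively_append_iff)
  then have "Suc n \<le> length r"
    using gdist_le[of V E u "r @ [v]" v "length r"] assms(4) by simp
  then have "n \<le> gdist V E u w" using r by (simp add: shortest_path_def)
  moreover have "gdist V E u w \<le> n" using gdist_le[OF wq lq] .
  moreover have "w \<in> set p" using q unfolding pq w_def by simp
  ultimately show thesis using that wV wv p by simp
qed

subsection \<open>Partial cubes\<close>

text \<open>\<open>hamming\<close> takes its index bound from the first word, so swapping the words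
  is harmless once the lengths agree.\<close>

lemma hamming_commute:
  "length xs = length ys \<Longrightarrow> hamming xs ys = hamming ys xs"
  unfolding hamming_def by (intro arg_cong[where f = card]) auto

lemma hamming_eq_1_obtain:
  assumes "hamming xs ys = 1"
  obtains i where "i < length xs" "xs ! i \<noteq> ys ! i"
    "\<And>j. j < length xs \<Longrightarrow> j \<noteq> i \<Longrightarrow> xs ! j = ys ! j"
proof -
  obtain i where "{i. i < length xs \<and> xs ! i \<noteq> ys ! i} = {i}"
    using assms unfolding hamming_def by (auto simp: card_1_singleton_iff)
  then show thesis using that by blast
qed

text \<open>Here \<open>ys\<close> is \<open>xs\<close> with bit \<open>i\<close> flipped. As
  \<open>zs\<close> agrees with \<open>xs\<close> at \<open>i\<close>, passing from
  \<open>xs\<close> to \<open>ys\<close> adds exactly the index \<open>i\<close> to the set of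
  disagreements with \<open>zs\<close>.\<close>

lemma hamming_flip:
  assumes "length zs = length xs" and "i < length xs" and "xs ! i \<noteq> ys ! i"
    and "\<And>j. j < length xs \<Longrightarrow> j \<noteq> i \<Longrightarrow> xs ! j = ys ! j"
    and "zs ! i = xs ! i"
  shows "hamming zs ys = Suc (hamming zs xs)"
proof -
  have "{j. j < length zs \<and> zs ! j \<noteq> ys ! j} = insert i {j. j < length zs \<and> zs ! j \<noteq> xs ! j}"
    using assms by (auto; metis)
  then show ?thesis using assms(5) unfolding hamming_def by simp
qed

text \<open>Isolates what the later argument needs from an isometric labelling: \<open>s i w\<close>
  is bit \<open>i\<close> of the label of \<open>w\<close>, and \<open>c e\<close> is the one
  coordinate in which the ends of \<open>e\<close> differ. Words and Hamming distances do not occur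
  after this point of the forward direction.\<close>

lemma partial_cube_edge_colouring:
  assumes G: "simple_graph V E" "connected_graph V E" and "partial_cube V E"
  obtains s :: "nat \<Rightarrow> 'a \<Rightarrow> bool" and c :: "'a set \<Rightarrow> nat" where
    "\<And>u v w. \<lbrakk>{u, v} \<in> E; w \<in> V; s (c {u, v}) w = s (c {u, v}) u\<rbrakk>
       \<Longrightarrow> gdist V E w v = Suc (gdist V E w u)"
    and "\<And>u v f. \<lbrakk>{u, v} \<in> E; f \<in> E\<rbrakk> \<Longrightarrow> s (c f) u \<noteq> s (c f) v \<longleftrightarrow> c {u, v} = c f"
    and "\<And>u v. \<lbrakk>u \<in> V; v \<in> V\<rbrakk> \<Longrightarrow> gdist V E u v = gdist V E v u"
proof -
  obtain p l where l: "l ` V \<subseteq> hypercube p"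
    "\<forall>u\<in>V. \<forall>v\<in>V. gdist V E u v = hamming (l u) (l v)"
    using assms(3) unfolding partial_cube_def by (elim exE conjE)
  then have len: "length (l u) = p" if "u \<in> V" for u
    using that by (auto simp: hypercube_def)
  have iso: "gdist V E u v = hamming (l u) (l v)" if "u \<in> V" "v \<in> V" for u v
    using l(2) that by (elim ballE) auto
  \<comment> \<open>Quantifying over both namings of the ends makes this a property of the edge
    alone, so the coordinate can be chosen as a function of \<open>e\<close>.\<close>
  define flips where "flips e i \<longleftrightarrow> i < p \<and> (\<forall>u v. e = {u, v} \<longrightarrow> l u ! i \<noteq> l v ! i \<and>
      (\<forall>j<p. j \<noteq> i \<longrightarrow> l u ! j = l v ! j))" for e i
  have "\<exists>i. flips e i" if e: "e \<in> E" for e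
  proof -
    obtain u v where uv: "e = {u, v}" using edge_obtain[OF G(1) e] .
    note vs = edge_vertices[OF G(1) e[unfolded uv]]
    have "hamming (l u) (l v) = 1"
      using gdist_edge[OF G e[unfolded uv]] iso vs by simp
    then obtain i where "i < p" "l u ! i \<noteq> l v ! i"
      "\<And>j. j < p \<Longrightarrow> j \<noteq> i \<Longrightarrow> l u ! j = l v ! j"
      using hamming_eq_1_obtain len[OF vs(1)] by metis
    then have "flips e i" unfolding flips_def uv by (auto simp: doubleton_eq_iff)
    then show ?thesis ..
  qed
  then obtain c where c: "\<And>e. e \<in> E \<Longrightarrow> flips e (c e)" by metis
  show thesis
  proof (rule that[of "\<lambda>i w. l w ! i" c])
    fix u v w
    assume uv: "{u, v} \<in> E" and w: "w \<in> V" and "l w ! c {u, v} = l u ! c {u, v}"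
    moreover note vs = edge_vertices[OF G(1) uv] and flip = c[OF uv, unfolded flips_def]
    ultimately have "hamming (l w) (l v) = Suc (hamming (l w) (l u))"
      using len by (intro hamming_flip[of _ _ "c {u, v}"]) auto
    then show "gdist V E w v = Suc (gdist V E w u)" using iso w vs by simp
  next
    fix u v f
    assume "{u, v} \<in> E" and "f \<in> E"
    then show "l u ! c f \<noteq> l v ! c f \<longleftrightarrow> c {u, v} = c f"
      using c[of "{u, v}"] c[of f] unfolding flips_def by metis
  next
    fix u v
    assume "u \<in> V" and "v \<in> V"
    then show "gdist V E u v = gdist V E v u"
      using iso len hamming_commute by metis
  qed
qed

text \<open>On \<open>E\<close>, both relations amount to \<open>c e = c f\<close>. The equivalence
  properties are then immediate, and the class of \<open>{u, v}\<close> consists of the edges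
  crossing between the two sides of coordinate \<open>c {u, v}\<close>.\<close>

lemma partial_cube_phi_theta_djokovic:
  assumes G: "simple_graph V E" "connected_graph V E" and "partial_cube V E"
  shows "phi_rel V E = theta_rel V E"
    and "equiv E (phi_rel V E)"
    and "E // phi_rel V E = {djokovic_cut V E u v | u v. {u, v} \<in> E}"
proof -
  obtain s :: "nat \<Rightarrow> 'a \<Rightarrow> bool" and c :: "'a set \<Rightarrow> nat" where
    near: "\<And>u v w. \<lbrakk>{u, v} \<in> E; w \<in> V; s (c {u, v}) w = s (c {u, v}) u\<rbrakk>
       \<Longrightarrow> gdist V E w v = Suc (gdist V E w u)"
    and flip: "\<And>u v f. \<lbrakk>{u, v} \<in> E; f \<in> E\<rbrakk> \<Longrightarrow> s (c f) u \<noteq> s (c f) v \<longleftrightarrow> c {u, v} = c f"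
    and sym: "\<And>u v. \<lbrakk>u \<in> V; v \<in> V\<rbrakk> \<Longrightarrow> gdist V E u v = gdist V E v u"
  proof (rule partial_cube_edge_colouring[OF assms], goal_cases)
    case (1 s c)
    show thesis by (rule 1(1)[of s c, OF 1(2-4)])
  qed
  \<comment> \<open>The mirror image of \<open>near\<close>: bits have two values and the edge flips
    this one, so a vertex that disagrees with \<open>u\<close> agrees with \<open>v\<close>.\<close>
  have far: "gdist V E w u = Suc (gdist V E w v)"
    if "{u, v} \<in> E" "w \<in> V" "s (c {u, v}) w \<noteq> s (c {u, v}) u" for u v w
  proof -
    have "s (c {u, v}) w = s (c {u, v}) v" using flip[of u v "{u, v}"] that by auto
    then show ?thesis using near[of v u w] that by (simp add: insert_commute[of v u])
  qed
  have pair: "(({u, v}, {x, y}) \<in> phi_rel V E \<longleftrightarrow> c {u, v} = c {x, y}) \<and>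
      (({u, v}, {x, y}) \<in> theta_rel V E \<longleftrightarrow> c {u, v} = c {x, y})"
    if uv: "{u, v} \<in> E" and xy: "{x, y} \<in> E" for u v x y
  proof -
    note vs = edge_vertices[OF G(1) uv] edge_vertices[OF G(1) xy]
    note swap = sym[OF vs(4) vs(1)] sym[OF vs(4) vs(2)] sym[OF vs(5) vs(1)] sym[OF vs(5) vs(2)]
    note dist = near[OF uv vs(4)] far[OF uv vs(4)] near[OF uv vs(5)] far[OF uv vs(5)]
      near[OF xy vs(1)] far[OF xy vs(1)] near[OF xy vs(2)] far[OF xy vs(2)]
    have e: "s (c {u, v}) u \<noteq> s (c {u, v}) v" and f: "s (c {x, y}) x \<noteq> s (c {x, y}) y"
      using flip[OF uv uv] flip[OF xy xy] by simp_all
    show ?thesis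
    proof (cases "c {u, v} = c {x, y}")
      case True
      show ?thesis
      \<comment> \<open>The split is by which end of \<open>{u, v}\<close> shares the side of
        \<open>x\<close>. Either way the two same-side distances equal some \<open>a\<close> and the
        two cross distances equal \<open>a + 1\<close>; hence \<open>\<phi>\<close> holds, and the
        sums for \<open>\<theta>\<close> differ by 2.\<close>
      proof (cases "s (c {u, v}) x = s (c {u, v}) u")
        case same: True
        then have "s (c {u, v}) y \<noteq> s (c {u, v}) u" "s (c {x, y}) u = s (c {x, y}) x"
          "s (c {x, y}) v \<noteq> s (c {x, y}) x"
          using e f True by auto
        then show ?thesis
          using dist(1,4,5,8) same swap True uv xy unfolding phi_rel_iff theta_rel_iff by simp
      next
        case diff: False
        then have "s (c {u, v}) y = s (c {u, v}) u" "s (c {x, y}) u \<noteq> s (c {x, y}) x"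
          "s (c {x, y}) v = s (c {x, y}) x"
          using e f True by auto
        then show ?thesis
          using dist(2,3,6,7) diff swap True uv xy unfolding phi_rel_iff theta_rel_iff by simp
      qed
    next
      \<comment> \<open>Now \<open>x\<close> and \<open>y\<close> lie on the same side of
        \<open>{u, v}\<close>, so replacing \<open>u\<close> by \<open>v\<close> shifts both
        distances by the same 1. The sums for \<open>\<theta>\<close> agree, while the two equations
        of \<open>\<phi>\<close> contradict each other.\<close>
      case False
      then have eq: "s (c {u, v}) x = s (c {u, v}) y" using flip[OF xy uv] by auto
      show ?thesis
      proof (cases "s (c {u, v}) x = s (c {u, v}) u")
        case same: True
        then show ?thesis
          using dist(1)[OF same] dist(3)[OF same[unfolded eq]] swap False
          unfolding phi_rel_iff theta_rel_iff by simp
      next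
        case diff: False
        then show ?thesis
          using dist(2)[OF diff] dist(4)[OF diff[unfolded eq]] swap False
          unfolding phi_rel_iff theta_rel_iff by simp
      qed
    qed
  qed
  have rel: "(e, f) \<in> phi_rel V E \<longleftrightarrow> c e = c f" "(e, f) \<in> theta_rel V E \<longleftrightarrow> c e = c f"
    if e: "e \<in> E" and f: "f \<in> E" for e f
  proof -
    obtain u v x y where "e = {u, v}" "f = {x, y}"
      using edge_obtain[OF G(1) e] edge_obtain[OF G(1) f] by metis
    then show "(e, f) \<in> phi_rel V E \<longleftrightarrow> c e = c f" "(e, f) \<in> theta_rel V E \<longleftrightarrow> c e = c f"
      using pair[of u v x y] e f by simp_all
  qed
  have "phi_rel V E \<subseteq> E \<times> E" "theta_rel V E \<subseteq> E \<times> E"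
    by (auto simp: phi_rel_def theta_rel_def)
  with rel have phi: "phi_rel V E = {(e, f). e \<in> E \<and> f \<in> E \<and> c e = c f}"
    and theta: "theta_rel V E = {(e, f). e \<in> E \<and> f \<in> E \<and> c e = c f}"
    by auto
  show "phi_rel V E = theta_rel V E" using phi theta by simp
  show "equiv E (phi_rel V E)"
    unfolding phi by (intro equivI refl_onI symI transI) auto
  have cut: "phi_rel V E `` {{u, v}} = djokovic_cut V E u v" if uv: "{u, v} \<in> E" for u v
  proof -
    \<comment> \<open>The distances from \<open>w\<close> to the two ends differ by exactly 1, so
      there are no ties: the two \<open>closer\<close> sets split \<open>V\<close> according to one
      bit.\<close>
    have side: "w \<in> closer V E u v \<longleftrightarrow> s (c {u, v}) w = s (c {u, v}) u"
      "w \<in> closer V E v u \<longleftrightarrow> s (c {u, v}) w \<noteq> s (c {u, v}) u" if "w \<in> V" for w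
    proof -
      have "gdist V E w u < gdist V E w v \<longleftrightarrow> s (c {u, v}) w = s (c {u, v}) u"
        "gdist V E w v < gdist V E w u \<longleftrightarrow> s (c {u, v}) w \<noteq> s (c {u, v}) u"
        using near[OF uv that] far[OF uv that] by linarith+
      then show "w \<in> closer V E u v \<longleftrightarrow> s (c {u, v}) w = s (c {u, v}) u"
        "w \<in> closer V E v u \<longleftrightarrow> s (c {u, v}) w \<noteq> s (c {u, v}) u"
        using that unfolding closer_def by simp_all
    qed
    have "f \<in> phi_rel V E `` {{u, v}} \<longleftrightarrow> f \<in> djokovic_cut V E u v" if f: "f \<in> E" for f
    proof -
      obtain x y where xy: "f = {x, y}" using edge_obtain[OF G(1) f] .
      note vs = edge_vertices[OF G(1) f[unfolded xy]]
      have "f \<in> phi_rel V E `` {{u, v}} \<longleftrightarrow> s (c {u, v}) x \<noteq> s (c {u, v}) y"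
        using flip[of x y "{u, v}"] f uv unfolding phi xy by auto
      also have "\<dots> \<longleftrightarrow> x \<in> closer V E u v \<and> y \<in> closer V E v u \<or>
          y \<in> closer V E u v \<and> x \<in> closer V E v u"
        using side[OF vs(1)] side[OF vs(2)] by auto
      also have "\<dots> \<longleftrightarrow> f \<in> djokovic_cut V E u v"
        using f unfolding djokovic_cut_def edges_between_def xy by (auto simp: doubleton_eq_iff)
      finally show ?thesis .
    qed
    moreover have "phi_rel V E `` {{u, v}} \<subseteq> E" "djokovic_cut V E u v \<subseteq> E"
      by (auto simp: phi_rel_def djokovic_cut_def edges_between_def)
    ultimately show ?thesis by blast
  qed
  show "E // phi_rel V E = {djokovic_cut V E u v | u v. {u, v} \<in> E}"
  proof (intro subset_antisym subsetI)
    fix F assume "F \<in> E // phi_rel V E"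
    then obtain e where e: "e \<in> E" "F = phi_rel V E `` {e}" by (auto elim: quotientE)
    obtain u v where "e = {u, v}" using edge_obtain[OF G(1) e(1)] .
    then show "F \<in> {djokovic_cut V E u v | u v. {u, v} \<in> E}" using e cut by auto
  next
    fix F assume "F \<in> {djokovic_cut V E u v | u v. {u, v} \<in> E}"
    then show "F \<in> E // phi_rel V E" using cut by (auto intro: quotientI simp flip: cut)
  qed
qed

subsection \<open>Partitions into convex cuts\<close>

text \<open>One side \<open>A F\<close> is fixed for each cut; the biconditional with one negation
  says that exactly one of \<open>u\<close> and \<open>v\<close> lies in it. The last edge of a
  shortest path changes the set of separating cuts by a single member.\<close>

lemma gdist_eq_card_separating_cuts:
  assumes conn: "connected_graph V E" and fin: "finite \<F>"
    and part: "\<And>e. e \<in> E \<Longrightarrow> \<exists>!F. F \<in> \<F> \<and> e \<in> F"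
    and cut: "\<And>F. F \<in> \<F> \<Longrightarrow> F = edges_between E (A F) (V - A F)"
    and conv: "\<And>F. F \<in> \<F> \<Longrightarrow> convex_in V E (A F) \<and> convex_in V E (V - A F)"
    and uv: "u \<in> V" "v \<in> V"
  shows "gdist V E u v = card {F \<in> \<F>. u \<in> A F \<longleftrightarrow> v \<notin> A F}"
  using uv(2)
proof (induction "gdist V E u v" arbitrary: v)
  case 0
  then have "u = v" using gdist_eq_0[OF conn uv(1)] by simp
  then show ?case using 0 by simp
next
  case (Suc n)
  obtain w p where w: "w \<in> V" "{w, v} \<in> E" "gdist V E u w = n"
    and p: "shortest_path V E u p v" "w \<in> set p"
    using shortest_path_last_edge[OF conn uv(1) Suc.prems Suc.hyps(2)[symmetric]] .
  have sep: "{w, v} \<in> F \<longleftrightarrow> (w \<in> A F \<longleftrightarrow> v \<notin> A F)" if "F \<in> \<F>" for F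
  proof -
    have "{w, v} \<in> F \<longleftrightarrow> {w, v} \<in> edges_between E (A F) (V - A F)"
      using cut[OF that] by simp
    then show ?thesis
      using w Suc.prems unfolding edges_between_def by (auto simp: doubleton_eq_iff)
  qed
  obtain F0 where F0: "F0 \<in> \<F>" "{w, v} \<in> F0"
    and unique: "\<And>F. F \<in> \<F> \<Longrightarrow> {w, v} \<in> F \<Longrightarrow> F = F0"
    using part[OF w(2)] by blast
  \<comment> \<open>If \<open>F0\<close> already separated \<open>u\<close> from \<open>w\<close>,
    then \<open>u\<close> and \<open>v\<close> would share a side. Convexity of that side would pull
    in \<open>w\<close>, which lies on \<open>p\<close>, although \<open>{w, v}\<close> crosses
    \<open>F0\<close>.\<close>
  have "u \<in> A F0 \<longleftrightarrow> w \<in> A F0"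
  proof (rule ccontr)
    assume "\<not> ?thesis"
    then have "u \<in> A F0 \<longleftrightarrow> v \<in> A F0" using sep F0 by blast
    then have "w \<in> A F0 \<longleftrightarrow> v \<in> A F0"
      using conv[OF F0(1)] p uv(1) Suc.prems unfolding convex_in_def by blast
    then show False using sep F0 by blast
  qed
  moreover have "w \<in> A F \<longleftrightarrow> v \<in> A F" if "F \<in> \<F>" "F \<noteq> F0" for F
    using sep unique that by blast
  ultimately have "{F \<in> \<F>. u \<in> A F \<longleftrightarrow> v \<notin> A F} =
      insert F0 {F \<in> \<F>. u \<in> A F \<longleftrightarrow> w \<notin> A F}"
    and "F0 \<notin> {F \<in> \<F>. u \<in> A F \<longleftrightarrow> w \<notin> A F}"
    using sep[OF F0(1)] F0 by blast+
  then show ?case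
    using Suc.hyps(1)[of w] Suc.hyps(2) w fin by simp
qed

text \<open>Distinctness makes positions and elements correspond bijectively, so counting differing
  bits counts the elements on which \<open>P\<close> and \<open>Q\<close> differ.\<close>

lemma hamming_map_distinct:
  assumes "distinct xs"
  shows "hamming (map P xs) (map Q xs) = card {x \<in> set xs. P x \<longleftrightarrow> \<not> Q x}"
proof -
  have "{x \<in> set xs. P x \<longleftrightarrow> \<not> Q x} =
      (!) xs ` {i. i < length (map P xs) \<and> map P xs ! i \<noteq> map Q xs ! i}"
    by (auto simp: in_set_conv_nth)
  moreover have "inj_on ((!) xs) {i. i < length (map P xs) \<and> map P xs ! i \<noteq> map Q xs ! i}"
    using assms by (intro inj_on_nth) auto
  ultimately show ?thesis unfolding hamming_def by (simp add: card_image)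
qed

lemma partial_cube_if_convex_cuts:
  assumes "connected_graph V E" and fin: "finite E" and eq: "equiv E r"
    and cuts: "\<forall>F \<in> E // r. convex_edge_cut V E F"
  shows "partial_cube V E"
proof -
  have "\<forall>F \<in> E // r. \<exists>A. F = edges_between E A (V - A) \<and>
      convex_in V E A \<and> convex_in V E (V - A)"
  proof
    fix F assume F: "F \<in> E // r"
    obtain A B where AB: "A \<union> B = V" "A \<inter> B = {}" "F = edges_between E A B"
      "convex_in V E A" "convex_in V E B"
      using cuts[rule_format, OF F] unfolding convex_edge_cut_def by (elim exE conjE)
    \<comment> \<open>The second side is determined by the first, so one choice function
      \<open>A\<close> suffices for all classes.\<close>
    moreover have "B = V - A" using AB(1,2) by blast
    ultimately show "\<exists>A. F = edges_between E A (V - A) \<and>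
        convex_in V E A \<and> convex_in V E (V - A)" by (intro exI[of _ A]) simp
  qed
  then obtain A where A: "\<And>F. F \<in> E // r \<Longrightarrow> F = edges_between E (A F) (V - A F)"
    "\<And>F. F \<in> E // r \<Longrightarrow> convex_in V E (A F) \<and> convex_in V E (V - A F)"
    by metis
  have finq: "finite (E // r)"
    using fin eq by (intro finite_quotient) (auto simp: equiv_def)
  have part: "\<exists>!F. F \<in> E // r \<and> e \<in> F" if "e \<in> E" for e
    using that Union_quotient[OF eq] quotient_disj[OF eq] by blast
  obtain Fs where Fs: "set Fs = E // r" "distinct Fs"
    using finite_distinct_list[OF finq] by blast
  \<comment> \<open>One coordinate per class: the bit records the side of the cut on which
    \<open>w\<close> lies.\<close>
  define l where "l w = map (\<lambda>F. w \<in> A F) Fs" for w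
  have "gdist V E u v = hamming (l u) (l v)" if "u \<in> V" "v \<in> V" for u v
    using gdist_eq_card_separating_cuts[OF assms(1) finq part A that]
    unfolding l_def hamming_map_distinct[OF Fs(2)] Fs(1) by simp
  moreover have "l ` V \<subseteq> hypercube (length Fs)" by (auto simp: hypercube_def l_def)
  ultimately show ?thesis unfolding partial_cube_def by blast
qed

theorem theorem2:
  fixes V :: "'a set" and E :: "'a set set"
  assumes "simple_graph V E" and "finite V" and "connected_graph V E"
  shows "(partial_cube V E \<longrightarrow>
            phi_rel V E = theta_rel V E \<and>
            equiv E (phi_rel V E) \<and>
            E // phi_rel V E = {djokovic_cut V E u v | u v. {u, v} \<in> E}) \<and>
         (bipartite_graph V E \<and> equiv E (phi_rel V E) \<and>
            (\<forall>F \<in> E // phi_rel V E. convex_edge_cut V E F) \<longrightarrow>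
            partial_cube V E \<and> E // theta_rel V E = E // phi_rel V E)"
proof -
  note cube = partial_cube_phi_theta_djokovic[OF assms(1,3)]
  have "partial_cube V E" if "equiv E (phi_rel V E)"
    and "\<forall>F \<in> E // phi_rel V E. convex_edge_cut V E F"
    using partial_cube_if_convex_cuts[OF assms(3) finite_edges[OF assms(1,2)] that] .
  \<comment> \<open>Once \<open>G\<close> is known to be a partial cube, the forward direction
    applies to it and identifies the two relations.\<close>
  moreover have "E // theta_rel V E = E // phi_rel V E" if "partial_cube V E"
    using cube(1)[OF that] by simp
  ultimately show ?thesis using cube by (intro conjI impI) (elim conjE; assumption | blast)+
qed

end
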